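(* In every network contribution game with nonnegative reward functions, every social optimum $s^*$ is a $2$-approximate equilibrium.
   Context: Network contribution game: a finite simple undirected graph $G=(V,E)$; every node $v\in V$ is a player with budget $B_v\ge 0$. Let $E_v$ be the set of edges incident to $v$. A strategy of $v$ is a function $s_v:E_v\to\mathbb{R}_{\ge 0}$ with $\sum_{e\in E_v}s_v(e)\le B_v$; a state $s=(s_v)_{v\in V}$ consists of one strategy per player. Each edge $e=(u,v)$ has a reward function $f_e:\mathbb{R}_{\ge 0}^2\to\mathbb{R}_{\ge 0}$, nondecreasing in each argument and symmetric. The utility of $v$ is $w_v(s)=\sum_{e=(v,u)\in E_v}f_e(s_v(e),s_u(e))$, and the social welfare is $w(s)=\sum_{v\in V}w_v(s)$. A social optimum $s^*$ is a state with $w(s^* )\ge w(s)$ for every state $s$. A state $s$ is an $\alpha$-approximate equilibrium if players may gain utility by deviating unilaterally or bilaterally, but not by more than a factor $\alpha$: there is no player $v$ and strategy $s_v'$ with $w_v(s_v',s_{-v})>\alpha\, w_v(s)$, and there are no two players $u\ne v$ and strategies $(s_u',s_v')$ such that both $w_u(s_u',s_v',s_{-u,v})>\alpha\, w_u(s)$ and $w_v(s_u',s_v',s_{-u,v})>\alpha\, w_v(s)$. *)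

theory Defs
  imports Complex_Main "HOL-Library.FuncSet"
begin

(* Edges are two-element vertex sets.  Since reward functions are curried functions on
   all of real, the conditions on them are imposed on the nonnegative quadrant only. *)
locale network_contribution_game =
  fixes V :: "'v set"
    and E :: "'v set set"
    and B :: "'v \<Rightarrow> real"
    and f :: "'v set \<Rightarrow> real \<Rightarrow> real \<Rightarrow> real"
  assumes finite_players: "finite V"
    and simple_edges: "\<And>e. e \<in> E \<Longrightarrow> e \<subseteq> V \<and> card e = 2"
    and budget_nonneg: "\<And>v. v \<in> V \<Longrightarrow> 0 \<le> B v"
    and reward_nonneg: "\<And>e x y. \<lbrakk>e \<in> E; 0 \<le> x; 0 \<le> y\<rbrakk> \<Longrightarrow> 0 \<le> f e x y"
    and reward_mono_left:
      "\<And>e x x' y. \<lbrakk>e \<in> E; 0 \<le> x; x \<le> x'; 0 \<le> y\<rbrakk> \<Longrightarrow> f e x y \<le> f e x' y"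
    and reward_mono_right:
      "\<And>e x y y'. \<lbrakk>e \<in> E; 0 \<le> x; 0 \<le> y; y \<le> y'\<rbrakk> \<Longrightarrow> f e x y \<le> f e x y'"
    and reward_sym: "\<And>e x y. \<lbrakk>e \<in> E; 0 \<le> x; 0 \<le> y\<rbrakk> \<Longrightarrow> f e x y = f e y x"
begin

definition incident :: "'v \<Rightarrow> 'v set set" where
  "incident v = {e \<in> E. v \<in> e}"

definition strategies :: "'v \<Rightarrow> ('v set \<Rightarrow> real) set" where
  "strategies v = {\<sigma> \<in> incident v \<rightarrow>\<^sub>E {0..}. (\<Sum>e\<in>incident v. \<sigma> e) \<le> B v}"

definition states :: "('v \<Rightarrow> 'v set \<Rightarrow> real) set" where
  "states = (\<Pi>\<^sub>E v\<in>V. strategies v)"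

(* Summing over the edges {v, u} incident to v is summing over the neighbours u of v. *)
definition utility :: "('v \<Rightarrow> 'v set \<Rightarrow> real) \<Rightarrow> 'v \<Rightarrow> real" where
  "utility s v = (\<Sum>u | {v, u} \<in> incident v. f {v, u} (s v {v, u}) (s u {v, u}))"

definition welfare :: "('v \<Rightarrow> 'v set \<Rightarrow> real) \<Rightarrow> real" where
  "welfare s = (\<Sum>v\<in>V. utility s v)"

definition social_optimum :: "('v \<Rightarrow> 'v set \<Rightarrow> real) \<Rightarrow> bool" where
  "social_optimum s \<longleftrightarrow> s \<in> states \<and> (\<forall>t\<in>states. welfare s \<ge> welfare t)"

definition approx_equilibrium :: "real \<Rightarrow> ('v \<Rightarrow> 'v set \<Rightarrow> real) \<Rightarrow> bool" where
  "approx_equilibrium \<alpha> s \<longleftrightarrow>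
     s \<in> states \<and>
     \<not> (\<exists>v\<in>V. \<exists>\<sigma>\<in>strategies v. utility (s(v := \<sigma>)) v > \<alpha> * utility s v) \<and>
     \<not> (\<exists>u\<in>V. \<exists>v\<in>V. u \<noteq> v \<and>
          (\<exists>\<sigma>\<in>strategies u. \<exists>\<tau>\<in>strategies v.
             utility (s(u := \<sigma>, v := \<tau>)) u > \<alpha> * utility s u \<and>
             utility (s(u := \<sigma>, v := \<tau>)) v > \<alpha> * utility s v))"

end

end

(* Let a coalition D deviate from an optimum s to t.  Pairs of players outside D are
   unaffected, so optimality bounds the rewards of all other ordered pairs: writing D x R for the
   total reward of pairs with one member in D and the other outside, we get
   2 (D x R)(t) + (D x D)(t) \<le> 2 (D x R)(s) + (D x D)(s).  The joint utility of D is
   D x R + D x D, so it at most doubles, and not every member can gain more than a factor 2. *)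
theory Submission
  imports Defs
begin

context network_contribution_game
begin

text \<open>The value 0 off the edges lets utilities range over all of \<open>V\<close>, so that
  double sums can be cut into blocks along \<open>D\<close> and \<open>V - D\<close>.\<close>

definition pair_reward :: "('v \<Rightarrow> 'v set \<Rightarrow> real) \<Rightarrow> 'v \<Rightarrow> 'v \<Rightarrow> real" where
  "pair_reward s v u =
     (if {v, u} \<in> E then f {v, u} (s v {v, u}) (s u {v, u}) else 0)"

text \<open>The conditions on \<open>f\<close> hold only on the nonnegative quadrant; this puts the
  arguments of every edge reward there.\<close>

lemma state_nonneg:
  assumes "s \<in> states" "{v, u} \<in> E"
  shows "0 \<le> s v {v, u}"
proof -
  have "v \<in> V"
    using simple_edges[OF assms(2)] by simp
  then have "s v \<in> strategies v"
    using assms(1) by (auto simp: states_def)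
  then show ?thesis
    using assms(2) by (auto simp: strategies_def incident_def PiE_def Pi_def)
qed

lemma pair_reward_nonneg:
  assumes "s \<in> states"
  shows "0 \<le> pair_reward s v u"
  using state_nonneg[OF assms, of v u] state_nonneg[OF assms, of u v]
  by (simp add: pair_reward_def reward_nonneg insert_commute)

lemma pair_reward_commute:
  assumes "s \<in> states"
  shows "pair_reward s v u = pair_reward s u v"
  using state_nonneg[OF assms, of v u] state_nonneg[OF assms, of u v]
  by (simp add: pair_reward_def reward_sym insert_commute)

lemma utility_eq_sum_pair_reward: "utility s v = (\<Sum>u\<in>V. pair_reward s v u)"
proof -
  have "{u. {v, u} \<in> incident v} = {u \<in> V. {v, u} \<in> E}"
    using simple_edges by (auto simp: incident_def)
  then show ?thesis
    using finite_players by (simp add: utility_def pair_reward_def sum.If_cases Int_def)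
qed

lemma utility_coalition:
  assumes "D \<subseteq> V"
  shows "(\<Sum>v\<in>D. utility s v) =
    (\<Sum>v\<in>D. \<Sum>u\<in>V - D. pair_reward s v u) + (\<Sum>v\<in>D. \<Sum>u\<in>D. pair_reward s v u)"
  by (simp add: utility_eq_sum_pair_reward sum.subset_diff[OF assms finite_players] sum.distrib)

text \<open>Cutting the sum over ordered pairs along \<open>D\<close> leaves two mixed blocks, which
  symmetry of the rewards makes equal; hence the factor 2. The block inside \<open>D\<close> already
  counts both orders of each pair.\<close>

lemma welfare_coalition:
  assumes "s \<in> states" "D \<subseteq> V"
  shows "welfare s =
    (\<Sum>v\<in>V - D. \<Sum>u\<in>V - D. pair_reward s v u) +
    2 * (\<Sum>v\<in>D. \<Sum>u\<in>V - D. pair_reward s v u) +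
    (\<Sum>v\<in>D. \<Sum>u\<in>D. pair_reward s v u)"
proof -
  have "(\<Sum>v\<in>V - D. \<Sum>u\<in>D. pair_reward s v u) = (\<Sum>u\<in>D. \<Sum>v\<in>V - D. pair_reward s v u)"
    by (rule sum.swap)
  also have "\<dots> = (\<Sum>u\<in>D. \<Sum>v\<in>V - D. pair_reward s u v)"
    by (simp add: pair_reward_commute[OF assms(1)])
  finally show ?thesis
    by (simp add: welfare_def utility_eq_sum_pair_reward
        sum.subset_diff[OF assms(2) finite_players] sum.distrib)
qed

lemma social_optimum_coalition_bound:
  assumes opt: "social_optimum s" and t: "t \<in> states" and D: "D \<subseteq> V"
    and agree: "\<And>v. v \<in> V - D \<Longrightarrow> t v = s v"
  shows "(\<Sum>v\<in>D. utility t v) \<le> 2 * (\<Sum>v\<in>D. utility s v)"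
proof -
  have s: "s \<in> states" and "welfare t \<le> welfare s"
    using opt t by (auto simp: social_optimum_def)
  moreover have "(\<Sum>v\<in>V - D. \<Sum>u\<in>V - D. pair_reward t v u) =
      (\<Sum>v\<in>V - D. \<Sum>u\<in>V - D. pair_reward s v u)"
    by (intro sum.cong refl) (simp add: pair_reward_def agree)
  \<comment> \<open>The two signs close the gap between welfare and joint utility: one mixed block
    of \<open>t\<close> is dropped on the left, and a second copy of the inner block of
    \<open>s\<close> is added on the right.\<close>
  moreover have "0 \<le> (\<Sum>v\<in>D. \<Sum>u\<in>V - D. pair_reward t v u)"
    by (intro sum_nonneg pair_reward_nonneg[OF t])
  moreover have "0 \<le> (\<Sum>v\<in>D. \<Sum>u\<in>D. pair_reward s v u)"
    by (intro sum_nonneg pair_reward_nonneg[OF s])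
  ultimately show ?thesis
    using welfare_coalition[OF s D] welfare_coalition[OF t D]
      utility_coalition[OF D, of s] utility_coalition[OF D, of t]
    by linarith
qed

lemma states_upd:
  assumes "s \<in> states" "v \<in> V" "\<sigma> \<in> strategies v"
  shows "s(v := \<sigma>) \<in> states"
  using assms by (auto simp: states_def PiE_def Pi_def extensional_def)

lemma social_optimum_imp_approx_equilibrium:
  assumes "social_optimum s"
  shows "approx_equilibrium 2 s"
proof -
  have s: "s \<in> states"
    using assms by (simp add: social_optimum_def)
  have "utility (s(v := \<sigma>)) v \<le> 2 * utility s v" if "v \<in> V" "\<sigma> \<in> strategies v" for v \<sigma>
    using social_optimum_coalition_bound[OF assms states_upd[OF s that], of "{v}"] that by simp
  \<comment> \<open>Bounding the sum suffices: if both players gained more than the factor 2, adding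
    their strict inequalities would contradict it.\<close>
  moreover have "utility (s(u := \<sigma>, v := \<tau>)) u + utility (s(u := \<sigma>, v := \<tau>)) v
      \<le> 2 * utility s u + 2 * utility s v"
    if "u \<in> V" "v \<in> V" "u \<noteq> v" "\<sigma> \<in> strategies u" "\<tau> \<in> strategies v" for u v \<sigma> \<tau>
    using social_optimum_coalition_bound[OF assms, of "s(u := \<sigma>, v := \<tau>)" "{u, v}"]
      states_upd s that by simp
  ultimately show ?thesis
    unfolding approx_equilibrium_def using s by (smt (verit))
qed

end

theorem theorem6p1:
  fixes V :: "'v set"
    and E :: "'v set set"
    and B :: "'v \<Rightarrow> real"
    and f :: "'v set \<Rightarrow> real \<Rightarrow> real \<Rightarrow> real"
    and s :: "'v \<Rightarrow> 'v set \<Rightarrow> real"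
  assumes "network_contribution_game V E B f"
    and "network_contribution_game.social_optimum V E B f s"
  shows "network_contribution_game.approx_equilibrium V E B f 2 s"
  using assms by (rule network_contribution_game.social_optimum_imp_approx_equilibrium)

end
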